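(* Let $(X,Y)$ be a pair of random variables with finite alphabets. Then $$\overline{G}(X;Y)\ge J(X;Y).$$
   Context: All random variables are discrete; $H$ denotes Shannon entropy and $I$ mutual information. $A\to W\to B$ means $A$ and $B$ are conditionally independent given $W$. Let $(X_i,Y_i)$, $i=1,2,\dots$, be i.i.d. copies of $(X,Y)$. Define $G(X^n;Y^n)=\min_{W_n:\,X^n\to W_n\to Y^n}H(W_n)$, the minimum being over all discrete $W_n$ jointly distributed with $(X^n,Y^n)$ (whose joint pmf is fixed), and $\overline{G}(X;Y)=\lim_{n\to\infty}\frac1nG(X^n;Y^n)$ (this limit exists and equals $\inf_n\frac1nG(X^n;Y^n)$). The Wyner common information is $J(X;Y)=\min_{W:\,X\to W\to Y}I(W;X,Y)$. *)

theory Defs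
  imports "HOL-Probability.Probability"
begin

text \<open>
  A pair of random variables is represented by its joint pmf.  Discrete auxiliary variables take
  their values in \<^typ>\<open>nat\<close>: a pmf has countable support, and entropy, mutual information and
  conditional independence are invariant under injective relabelling.  Logarithms are to base 2.
\<close>

text \<open>
  The library's \<open>prob_space.entropy\<close> is a Bochner integral and so equals 0 when the true entropy is
  infinite, which can happen for a countably infinite alphabet; an infimum over all discrete
  variables needs the value in \<^typ>\<open>ennreal\<close>.  The lemma below shows that the two notions agree
  whenever the entropy is finite.
\<close>

definition shannon_entropy :: "'w pmf \<Rightarrow> ennreal" where
  "shannon_entropy p = (\<integral>\<^sup>+ w. ennreal (- log 2 (pmf p w)) \<partial>measure_pmf p)"

lemma shannon_entropy_eq_entropy:
  fixes p :: "'w :: countable pmf"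
  assumes "shannon_entropy p < \<infinity>"
  shows "shannon_entropy p =
    ennreal (prob_space.entropy (measure_pmf p) 2 (count_space UNIV) (\<lambda>w. w))"
proof -
  have info: "information_space (measure_pmf p) 2"
    by unfold_locales simp
  have nonneg: "AE w in measure_pmf p. 0 \<le> - log 2 (pmf p w)"
    by (rule AE_pmfI) (simp add: pmf_positive pmf_le_1)
  have int: "integrable (measure_pmf p) (\<lambda>w. - log 2 (pmf p w))"
    by (rule integrableI_nonneg) (use assms nonneg in \<open>auto simp: shannon_entropy_def\<close>)
  have "distributed (measure_pmf p) (count_space UNIV) (\<lambda>w. w) (pmf p)"
    unfolding distributed_def by (simp add: distr_id2 measure_pmf_eq_density)
  then have "prob_space.entropy (measure_pmf p) 2 (count_space UNIV) (\<lambda>w. w) =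
      - (\<integral>w. pmf p w * log 2 (pmf p w) \<partial>count_space UNIV)"
    by (rule information_space.entropy_distr[OF info]) simp
  also have "\<dots> = (\<integral>w. - log 2 (pmf p w) \<partial>measure_pmf p)"
    by (simp add: measure_pmf_eq_density integral_density)
  finally show ?thesis
    unfolding shannon_entropy_def by (simp add: nn_integral_eq_integral[OF int nonneg])
qed

definition cond_indep :: "'s pmf \<Rightarrow> ('s \<Rightarrow> 'a) \<Rightarrow> ('s \<Rightarrow> 'w) \<Rightarrow> ('s \<Rightarrow> 'b) \<Rightarrow> bool" where
  "cond_indep Q A W B \<longleftrightarrow>
     (\<forall>w \<in> W ` set_pmf Q. let C = cond_pmf Q (W -` {w}) in
        map_pmf (\<lambda>s. (A s, B s)) C = pair_pmf (map_pmf A C) (map_pmf B C))"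

text \<open>
  Joint laws of \<open>((X, Y), W)\<close> with \<open>X \<rightarrow> W \<rightarrow> Y\<close> and prescribed law of \<open>(X, Y)\<close>.
  Minima over such laws are expressed as infima.
\<close>

definition markov_couplings :: "('a \<times> 'b) pmf \<Rightarrow> (('a \<times> 'b) \<times> nat) pmf set" where
  "markov_couplings P = {Q. map_pmf fst Q = P \<and> cond_indep Q (fst \<circ> fst) snd (snd \<circ> fst)}"

definition common_entropy :: "('a \<times> 'b) pmf \<Rightarrow> ennreal" where
  "common_entropy P = (INF Q \<in> markov_couplings P. shannon_entropy (map_pmf snd Q))"

text \<open>The joint law of \<open>(X\<^sup>n, Y\<^sup>n)\<close> for i.i.d. copies of \<open>(X, Y)\<close>.\<close>

definition iid_pairs :: "nat \<Rightarrow> ('a \<times> 'b) pmf \<Rightarrow> ('a list \<times> 'b list) pmf" where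
  "iid_pairs n P = map_pmf (\<lambda>xys. (map fst xys, map snd xys)) (replicate_pmf n P)"

definition common_entropy_rate :: "('a \<times> 'b) pmf \<Rightarrow> ennreal" where
  "common_entropy_rate P = lim (\<lambda>n. common_entropy (iid_pairs n P) / of_nat n)"

text \<open>
  As \<open>X\<close> and \<open>Y\<close> have finite alphabets, \<open>I(W; X, Y)\<close> is finite and nonnegative, so neither the
  real-valued \<open>prob_space.mutual_information\<close> nor the coercion loses anything.
\<close>

definition wyner_common_information :: "('a :: finite \<times> 'b :: finite) pmf \<Rightarrow> ennreal" where
  "wyner_common_information P = (INF Q \<in> markov_couplings P.
     ennreal (prob_space.mutual_information (measure_pmf Q) 2
       (count_space UNIV) (count_space UNIV) snd fst))"

end

theory Submission
  imports Defs
begin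

text \<open>
  Let \<open>W\<close> be admissible for \<open>(X\<^sup>n, Y\<^sup>n)\<close> and put \<open>Z\<^sub>i = (X\<^sub>i, Y\<^sub>i)\<close>.  Each marginal \<open>(Z\<^sub>i, W)\<close> is
  admissible for \<open>(X, Y)\<close>, so \<open>J(X; Y) \<le> I(W; Z\<^sub>i)\<close>, and the independence of the \<open>Z\<^sub>i\<close> gives
  \<open>\<Sum>\<^sub>i I(W; Z\<^sub>i) \<le> I(W; Z\<^sup>n) \<le> H(W)\<close>.  The two inequalities are obtained in one step: the random
  variable \<open>U = p(W) \<Prod>\<^sub>i p(Z\<^sub>i | W) / p(Z\<^sub>i)\<close> has mean at most 1 because \<open>p(W, Z\<^sup>n) \<le> \<Prod>\<^sub>i p(Z\<^sub>i)\<close>, and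
  \<open>ln U \<le> U - 1\<close>.  The limit defining the rate exists by Fekete's lemma, since independent
  couplings can be juxtaposed.
\<close>

section \<open>Disintegration: Markov couplings as mixtures of product laws\<close>

definition kernel_coupling :: "'w pmf \<Rightarrow> ('w \<Rightarrow> 'z pmf) \<Rightarrow> ('z \<times> 'w) pmf" where
  "kernel_coupling V K = bind_pmf V (\<lambda>w. map_pmf (\<lambda>z. (z, w)) (K w))"

lemma map_fst_kernel_coupling [simp]: "map_pmf fst (kernel_coupling V K) = bind_pmf V K"
  by (simp add: kernel_coupling_def map_bind_pmf map_pmf_comp)

lemma map_snd_kernel_coupling [simp]: "map_pmf snd (kernel_coupling V K) = V"
  by (simp add: kernel_coupling_def map_bind_pmf map_pmf_comp bind_return_pmf')

lemma set_kernel_coupling: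
  "set_pmf (kernel_coupling V K) = {(z, w). w \<in> set_pmf V \<and> z \<in> set_pmf (K w)}"
  by (auto simp: kernel_coupling_def)

lemma pmf_kernel_coupling:
  "pmf (kernel_coupling V K) (z, w) = pmf V w * pmf (K w) z"
proof -
  have "pmf (map_pmf (\<lambda>z. (z, v)) (K v)) (z, w) = pmf (K w) z * indicator {w} v" for v
  proof (cases "v = w")
    case True
    then show ?thesis
      using pmf_map_inj'[of "\<lambda>z. (z, w)" "K w" z] by (simp add: inj_on_def)
  next
    case False
    then have "(z, w) \<notin> set_pmf (map_pmf (\<lambda>z. (z, v)) (K v))"
      by auto
    then show ?thesis
      using False by (simp add: pmf_eq_0_set_pmf)
  qed
  then show ?thesis
    by (simp add: kernel_coupling_def pmf_bind measure_pmf_single)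
qed

lemma nn_integral_kernel_coupling:
  "(\<integral>\<^sup>+ x. f x \<partial>kernel_coupling V K) = (\<integral>\<^sup>+ w. \<integral>\<^sup>+ z. f (z, w) \<partial>K w \<partial>V)"
  by (simp add: kernel_coupling_def)

lemma measure_pmf_snd_vimage: "measure (measure_pmf Q) (snd -` {w}) = pmf (map_pmf snd Q) w"
  by (simp add: pmf_map)

text \<open>Bayes' rule on the support of \<open>W\<close>; elsewhere both sides vanish, so the
  unspecified value of \<open>cond_pmf\<close> there does no harm.\<close>

lemma kernel_coupling_disintegration:
  "Q = kernel_coupling (map_pmf snd Q) (\<lambda>w. map_pmf fst (cond_pmf Q (snd -` {w})))"
proof (rule pmf_eqI)
  fix zw :: "'a \<times> 'b"
  obtain z w where zw: "zw = (z, w)"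
    by force
  show "pmf Q zw =
      pmf (kernel_coupling (map_pmf snd Q) (\<lambda>w. map_pmf fst (cond_pmf Q (snd -` {w})))) zw"
  proof (cases "w \<in> snd ` set_pmf Q")
    case True
    then have ne: "set_pmf Q \<inter> snd -` {w} \<noteq> {}"
      by auto
    let ?C = "cond_pmf Q (snd -` {w})"
    \<comment> \<open>Under \<open>?C\<close> the second component is almost surely
      \<open>w\<close>, so the fibre of \<open>fst\<close> over \<open>z\<close> has the mass of the
      single point \<open>(z, w)\<close>.\<close>
    have "pmf (map_pmf fst ?C) z = pmf ?C (z, w)"
    proof -
      have "pmf (map_pmf fst ?C) z = measure ?C (fst -` {z})"
        by (simp add: pmf_map)
      also have "\<dots> = measure ?C {(z, w)}"
        by (intro measure_pmf.finite_measure_eq_AE) (auto simp: AE_measure_pmf_iff set_cond_pmf[OF ne])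
      finally show ?thesis
        by (simp add: measure_pmf_single)
    qed
    moreover have "pmf (map_pmf snd Q) w \<noteq> 0"
      using True by (simp add: set_pmf_iff[symmetric])
    ultimately show ?thesis
      by (simp add: zw pmf_kernel_coupling pmf_cond[OF ne] measure_pmf_snd_vimage)
  next
    case False
    then have "pmf (map_pmf snd Q) w = 0" "pmf Q (z, w) = 0"
      by (force simp: pmf_eq_0_set_pmf)+
    then show ?thesis
      by (simp add: zw pmf_kernel_coupling)
  qed
qed

lemma cond_kernel_coupling:
  assumes w: "w \<in> set_pmf V"
  shows "cond_pmf (kernel_coupling V K) (snd -` {w}) = map_pmf (\<lambda>z. (z, w)) (K w)"
proof (rule pmf_eqI)
  fix x :: "'b \<times> 'a"
  obtain z v where x: "x = (z, v)"
    by force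
  obtain y where "y \<in> set_pmf (K w)"
    using set_pmf_not_empty by fast
  then have "(y, w) \<in> set_pmf (kernel_coupling V K) \<inter> snd -` {w}"
    using w by (simp add: set_kernel_coupling)
  then have ne: "set_pmf (kernel_coupling V K) \<inter> snd -` {w} \<noteq> {}"
    by blast
  have pos: "pmf V w \<noteq> 0"
    using w by (simp add: set_pmf_iff)
  show "pmf (cond_pmf (kernel_coupling V K) (snd -` {w})) x = pmf (map_pmf (\<lambda>z. (z, w)) (K w)) x"
  proof (cases "v = w")
    case True
    then show ?thesis
      using pos pmf_map_inj'[of "\<lambda>z. (z, w)" "K w" z]
      by (simp add: x pmf_cond[OF ne] pmf_kernel_coupling measure_pmf_snd_vimage inj_on_def)
  next
    case False
    then have "(z, v) \<notin> set_pmf (map_pmf (\<lambda>z. (z, w)) (K w))"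
      by auto
    then show ?thesis
      using False by (simp add: x pmf_cond[OF ne] pmf_eq_0_set_pmf)
  qed
qed

text \<open>Given \<open>w\<close>, the law of the pair is a product, which is conditional
  independence. Together with the converse below, this lets later arguments work with kernels and
  avoid \<open>cond_pmf\<close>.\<close>

lemma kernel_coupling_in_markov_couplings:
  assumes "bind_pmf V (\<lambda>w. pair_pmf (A w) (B w)) = P"
  shows "kernel_coupling V (\<lambda>w. pair_pmf (A w) (B w)) \<in> markov_couplings P"
proof -
  have "snd ` set_pmf (kernel_coupling V (\<lambda>w. pair_pmf (A w) (B w))) = set_pmf V"
    using map_snd_kernel_coupling[of V] by (metis set_map_pmf)
  then have "cond_indep (kernel_coupling V (\<lambda>w. pair_pmf (A w) (B w))) (fst \<circ> fst) snd (snd \<circ> fst)"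
    unfolding cond_indep_def
    \<comment> \<open>The chained fact first turns the range of \<open>w\<close> into
      \<open>set_pmf V\<close>, the membership that \<open>cond_kernel_coupling\<close>
      requires.\<close>
    by (simp only:) (simp add: Let_def cond_kernel_coupling map_pmf_comp map_fst_pair_pmf map_snd_pair_pmf)
  then show ?thesis
    using assms by (simp add: markov_couplings_def)
qed

text \<open>\<open>A\<close> and \<open>B\<close> are the conditional marginals. They are meaningful
  only on the support of \<open>V\<close>, and \<open>kernel_coupling\<close> depends on no other
  values.\<close>

lemma markov_couplings_kernel_cases:
  assumes "Q \<in> markov_couplings P"
  obtains V A B where "Q = kernel_coupling V (\<lambda>w. pair_pmf (A w) (B w))"
    and "bind_pmf V (\<lambda>w. pair_pmf (A w) (B w)) = P"
proof -
  define V where "V = map_pmf snd Q"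
  define A where "A w = map_pmf (fst \<circ> fst) (cond_pmf Q (snd -` {w}))" for w
  define B where "B w = map_pmf (snd \<circ> fst) (cond_pmf Q (snd -` {w}))" for w
  have fst: "map_pmf fst Q = P"
    and ci: "\<And>w. w \<in> set_pmf V \<Longrightarrow> map_pmf fst (cond_pmf Q (snd -` {w})) = pair_pmf (A w) (B w)"
    using assms by (auto simp: markov_couplings_def cond_indep_def Let_def V_def A_def B_def comp_def)
  have Q: "Q = kernel_coupling V (\<lambda>w. pair_pmf (A w) (B w))"
    by (subst kernel_coupling_disintegration[of Q])
      (simp add: kernel_coupling_def V_def[symmetric] ci cong: bind_pmf_cong_simp)
  then have "bind_pmf V (\<lambda>w. pair_pmf (A w) (B w)) = P"
    using fst map_fst_kernel_coupling by metis
  with Q show thesis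
    by (rule that)
qed

section \<open>Additivity of entropy and subadditivity of common entropy\<close>

lemma shannon_entropy_map_inj:
  assumes "inj f"
  shows "shannon_entropy (map_pmf f p) = shannon_entropy p"
  using assms by (simp add: shannon_entropy_def pmf_map_inj')

text \<open>On the support both negated logarithms are nonnegative, so \<open>ennreal\<close> is
  additive there; infinite entropies are covered as well.\<close>

lemma shannon_entropy_pair_pmf:
  "shannon_entropy (pair_pmf p q) = shannon_entropy p + shannon_entropy q"
proof -
  have "shannon_entropy (pair_pmf p q) =
      (\<integral>\<^sup>+ x. ennreal (- log 2 (pmf p (fst x))) + ennreal (- log 2 (pmf q (snd x))) \<partial>pair_pmf p q)"
    unfolding shannon_entropy_def
  proof (intro nn_integral_cong_AE AE_pmfI)
    fix x assume "x \<in> set_pmf (pair_pmf p q)"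
    then have pos: "0 < pmf p (fst x)" "0 < pmf q (snd x)"
      by (auto simp: pmf_positive)
    then have "ennreal (- log 2 (pmf p (fst x))) + ennreal (- log 2 (pmf q (snd x))) =
        ennreal (- log 2 (pmf p (fst x)) + - log 2 (pmf q (snd x)))"
      by (intro ennreal_plus[symmetric]) (simp_all add: pmf_le_1)
    then show "ennreal (- log 2 (pmf (pair_pmf p q) x)) =
        ennreal (- log 2 (pmf p (fst x))) + ennreal (- log 2 (pmf q (snd x)))"
      using pos by (cases x) (simp add: pmf_pair log_mult)
  qed
  also have "\<dots> = shannon_entropy p + shannon_entropy q"
    by (simp add: nn_integral_add nn_integral_pair_pmf' shannon_entropy_def)
  finally show ?thesis .
qed

lemma shannon_entropy_finite_support:
  assumes "finite (set_pmf p)"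
  shows "shannon_entropy p < \<infinity>"
proof -
  have "shannon_entropy p = (\<Sum>x\<in>set_pmf p. ennreal (- log 2 (pmf p x)) * ennreal (pmf p x))"
    unfolding shannon_entropy_def by (rule nn_integral_measure_pmf_finite[OF assms]) simp
  also have "\<dots> < \<top>"
    using ennreal_sum_less_top[OF assms] by (simp only: ennreal_mult_less_top) simp
  finally show ?thesis
    by simp
qed

lemma common_entropy_le:
  fixes V :: "nat pmf"
  assumes "bind_pmf V (\<lambda>w. pair_pmf (A w) (B w)) = P"
  shows "common_entropy P \<le> shannon_entropy V"
  unfolding common_entropy_def
  by (rule INF_lower2[OF kernel_coupling_in_markov_couplings[OF assms]]) simp

text \<open>The witness is \<open>W = (X, Y)\<close>, encoded as a number: given \<open>W\<close>,
  both variables are constant and hence independent.\<close>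

lemma common_entropy_finite:
  fixes P :: "('a :: countable \<times> 'b :: countable) pmf"
  assumes "finite (set_pmf P)"
  shows "common_entropy P < \<infinity>"
proof -
  have "bind_pmf (map_pmf to_nat P) (\<lambda>w. pair_pmf
      (return_pmf (fst (from_nat w :: 'a \<times> 'b))) (return_pmf (snd (from_nat w :: 'a \<times> 'b)))) = P"
    by (simp add: bind_map_pmf bind_return_pmf')
  then have "common_entropy P \<le> shannon_entropy (map_pmf to_nat P)"
    by (rule common_entropy_le)
  also have "\<dots> < \<infinity>"
    using assms by (intro shannon_entropy_finite_support) simp
  finally show ?thesis .
qed

text \<open>Independent auxiliary variables for \<open>P\<close> and \<open>P'\<close> are joined
  into one. Given both, \<open>f x x'\<close> and \<open>g y y'\<close> are independent, and the
  entropies add. Appending lists is the instance needed for blocks.\<close>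

lemma common_entropy_product_le:
  "common_entropy (map_pmf (\<lambda>((x, y), (x', y')). (f x x', g y y')) (pair_pmf P P'))
    \<le> common_entropy P + common_entropy P'" (is "common_entropy ?R \<le> _")
proof -
  have le: "common_entropy ?R \<le> shannon_entropy (map_pmf snd Q) + shannon_entropy (map_pmf snd Q')"
    if "Q \<in> markov_couplings P" "Q' \<in> markov_couplings P'" for Q Q'
  proof -
    obtain V A B where Q: "Q = kernel_coupling V (\<lambda>w. pair_pmf (A w) (B w))"
      and P: "bind_pmf V (\<lambda>w. pair_pmf (A w) (B w)) = P"
      by (rule markov_couplings_kernel_cases[OF \<open>Q \<in> _\<close>])
    obtain V' A' B' where Q': "Q' = kernel_coupling V' (\<lambda>w. pair_pmf (A' w) (B' w))"
      and P': "bind_pmf V' (\<lambda>w. pair_pmf (A' w) (B' w)) = P'"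
      by (rule markov_couplings_kernel_cases[OF \<open>Q' \<in> _\<close>])
    \<comment> \<open>The joint auxiliary variable must be a natural number, so the pair
      \<open>(v, v')\<close> travels through \<open>prod_encode\<close>.\<close>
    define A2 where "A2 w = (case prod_decode w of (v, v') \<Rightarrow> map_pmf (\<lambda>(x, x'). f x x') (pair_pmf (A v) (A' v')))" for w
    define B2 where "B2 w = (case prod_decode w of (v, v') \<Rightarrow> map_pmf (\<lambda>(y, y'). g y y') (pair_pmf (B v) (B' v')))" for w
    have "bind_pmf (map_pmf prod_encode (pair_pmf V V')) (\<lambda>w. pair_pmf (A2 w) (B2 w)) =
      bind_pmf V (\<lambda>v. bind_pmf V' (\<lambda>v'. bind_pmf (A v) (\<lambda>x. bind_pmf (A' v') (\<lambda>x'.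
        bind_pmf (B v) (\<lambda>y. bind_pmf (B' v') (\<lambda>y'. return_pmf (f x x', g y y')))))))"
      by (simp add: A2_def B2_def pair_pmf_def map_pmf_def bind_assoc_pmf bind_return_pmf)
    \<comment> \<open>Three swaps of adjacent draws, neither depending on the other, bring all draws
      for \<open>P\<close> before those for \<open>P'\<close>; the number given to
      \<open>subst\<close> selects the swap.\<close>
    also have "\<dots> = bind_pmf V (\<lambda>v. bind_pmf V' (\<lambda>v'. bind_pmf (A v) (\<lambda>x. bind_pmf (B v) (\<lambda>y.
        bind_pmf (A' v') (\<lambda>x'. bind_pmf (B' v') (\<lambda>y'. return_pmf (f x x', g y y')))))))"
      by (subst (3) bind_commute_pmf) (rule refl)
    also have "\<dots> = bind_pmf V (\<lambda>v. bind_pmf (A v) (\<lambda>x. bind_pmf V' (\<lambda>v'. bind_pmf (B v) (\<lambda>y.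
        bind_pmf (A' v') (\<lambda>x'. bind_pmf (B' v') (\<lambda>y'. return_pmf (f x x', g y y')))))))"
      by (subst (2) bind_commute_pmf) (rule refl)
    also have "\<dots> = bind_pmf V (\<lambda>v. bind_pmf (A v) (\<lambda>x. bind_pmf (B v) (\<lambda>y. bind_pmf V' (\<lambda>v'.
        bind_pmf (A' v') (\<lambda>x'. bind_pmf (B' v') (\<lambda>y'. return_pmf (f x x', g y y')))))))"
      by (subst (3) bind_commute_pmf) (rule refl)
    also have "\<dots> = ?R"
      by (simp add: P[symmetric] P'[symmetric] pair_pmf_def map_pmf_def bind_assoc_pmf bind_return_pmf)
    finally have "common_entropy ?R \<le> shannon_entropy (map_pmf prod_encode (pair_pmf V V'))"
      by (rule common_entropy_le)
    then show ?thesis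
      by (simp add: Q Q' shannon_entropy_map_inj inj_prod_encode shannon_entropy_pair_pmf)
  qed
  show ?thesis
  proof (rule ennreal_le_epsilon)
    fix e :: real assume "0 < e" "common_entropy P + common_entropy P' < \<top>"
    \<comment> \<open>The infima are not known to be attained, so each is approached within
      \<open>e / 2\<close>; finiteness makes these inequalities strict.\<close>
    then have less: "common_entropy P < common_entropy P + ennreal (e / 2)"
      "common_entropy P' < common_entropy P' + ennreal (e / 2)"
      by (simp_all add: ennreal_add_less_top less_top)
    obtain Q where Q: "Q \<in> markov_couplings P"
        "shannon_entropy (map_pmf snd Q) < common_entropy P + ennreal (e / 2)"
      using less(1) by (subst (asm) (1) common_entropy_def) (auto simp: INF_less_iff)
    obtain Q' where Q': "Q' \<in> markov_couplings P'"
        "shannon_entropy (map_pmf snd Q') < common_entropy P' + ennreal (e / 2)"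
      using less(2) by (subst (asm) (1) common_entropy_def) (auto simp: INF_less_iff)
    have "common_entropy ?R \<le> shannon_entropy (map_pmf snd Q) + shannon_entropy (map_pmf snd Q')"
      by (rule le[OF Q(1) Q'(1)])
    also have "\<dots> \<le> (common_entropy P + ennreal (e / 2)) + (common_entropy P' + ennreal (e / 2))"
      using Q(2) Q'(2) by (intro add_mono) auto
    also have "\<dots> = common_entropy P + common_entropy P' + (ennreal (e / 2) + ennreal (e / 2))"
      by (simp add: ac_simps)
    also have "ennreal (e / 2) + ennreal (e / 2) = ennreal e"
      using \<open>0 < e\<close> by (subst ennreal_plus[symmetric]) auto
    finally show "common_entropy ?R \<le> common_entropy P + common_entropy P' + ennreal e" .
  qed
qed

lemma iid_pairs_add:
  "iid_pairs (m + n) P =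
    map_pmf (\<lambda>((x, y), (x', y')). (x @ x', y @ y')) (pair_pmf (iid_pairs m P) (iid_pairs n P))"
  by (simp add: iid_pairs_def replicate_pmf_distrib pair_pmf_def map_pmf_def bind_assoc_pmf
      bind_return_pmf)

lemma common_entropy_iid_pairs_add:
  "common_entropy (iid_pairs (m + n) P) \<le>
    common_entropy (iid_pairs m P) + common_entropy (iid_pairs n P)"
  unfolding iid_pairs_add by (rule common_entropy_product_le)

lemma common_entropy_iid_pairs_finite:
  fixes P :: "('a :: finite \<times> 'b :: finite) pmf"
  shows "common_entropy (iid_pairs n P) < \<infinity>"
proof (rule common_entropy_finite)
  have "set_pmf (replicate_pmf n P) \<subseteq> {xs. set xs \<subseteq> UNIV \<and> length xs = n}"
    by (auto simp: set_replicate_pmf)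
  then have "finite (set_pmf (replicate_pmf n P))"
    by (rule finite_subset) (rule finite_lists_length_eq, simp)
  then show "finite (set_pmf (iid_pairs n P))"
    by (simp add: iid_pairs_def)
qed

section \<open>Probabilities of i.i.d. lists and products of marginals\<close>

lemma pmf_replicate_pmf:
  "pmf (replicate_pmf n p) xs = (if length xs = n then \<Prod>i<n. pmf p (xs ! i) else 0)"
proof (induction n arbitrary: xs)
  case 0
  then show ?case
    by (auto simp: pmf_return)
next
  case (Suc n)
  have eq: "replicate_pmf (Suc n) p = map_pmf (\<lambda>(x, xs). x # xs) (pair_pmf p (replicate_pmf n p))"
    by (simp add: pair_pmf_def map_bind_pmf)
  show ?case
  proof (cases xs)
    case Nil
    then have "xs \<notin> set_pmf (replicate_pmf (Suc n) p)"
      by (auto simp: set_replicate_pmf)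
    then show ?thesis
      using Nil by (simp add: pmf_eq_0_set_pmf del: replicate_pmf.simps)
  next
    case (Cons y ys)
    have "inj (\<lambda>(x, xs). x # xs :: 'a list)"
      by (auto simp: inj_on_def)
    from pmf_map_inj'[OF this, of "pair_pmf p (replicate_pmf n p)" "(y, ys)"]
    have "pmf (replicate_pmf (Suc n) p) xs = pmf p y * pmf (replicate_pmf n p) ys"
      by (simp add: eq Cons pmf_pair del: replicate_pmf.simps)
    then show ?thesis
      by (simp add: Suc.IH Cons prod.lessThan_Suc_shift del: replicate_pmf.simps prod.lessThan_Suc)
  qed
qed

lemma map_nth_replicate_pmf:
  "i < n \<Longrightarrow> map_pmf (\<lambda>xs. xs ! i) (replicate_pmf n p) = p"
proof (induction n arbitrary: i)
  case (Suc n)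
  then show ?case
    by (cases i) (simp_all add: map_bind_pmf map_pmf_comp bind_return_pmf' bind_pmf_const flip: map_pmf_def)
qed simp

text \<open>The integrand is the pmf of the product law \<open>Pi_pmf\<close> and lists of length
  \<open>n\<close> embed into its functions, so the integral is the probability of a set.\<close>

lemma nn_integral_lists_prod_pmf_le_1:
  "(\<integral>\<^sup>+ xs. ennreal (\<Prod>i<n. pmf (p i) (xs ! i)) \<partial>count_space {xs. length xs = n}) \<le> 1"
proof -
  \<comment> \<open>\<open>undefined\<close> is the default that \<open>Pi_pmf\<close> prescribes
    outside \<open>{..<n}\<close>.\<close>
  define f :: "'a list \<Rightarrow> nat \<Rightarrow> 'a" where "f xs = (\<lambda>i. if i < n then xs ! i else undefined)" for xs
  have inj: "inj_on f {xs. length xs = n}"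
  proof (rule inj_onI)
    fix xs ys assume *: "xs \<in> {xs. length xs = n}" "ys \<in> {xs. length xs = n}" "f xs = f ys"
    then have "xs ! i = ys ! i" if "i < n" for i
    proof -
      have "f xs i = f ys i"
        using * by simp
      then show ?thesis
        using that by (simp add: f_def)
    qed
    then show "xs = ys"
      using * by (auto intro: nth_equalityI)
  qed
  have "(\<integral>\<^sup>+ xs. ennreal (\<Prod>i<n. pmf (p i) (xs ! i)) \<partial>count_space {xs. length xs = n}) =
      (\<integral>\<^sup>+ xs. ennreal (pmf (Pi_pmf {..<n} undefined p) (f xs)) \<partial>count_space {xs. length xs = n})"
    by (intro nn_integral_cong arg_cong[where f = ennreal], subst pmf_Pi') (auto simp: f_def)
  also have "\<dots> = emeasure (Pi_pmf {..<n} undefined p) (f ` {xs. length xs = n})"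
    by (rule nn_integral_pmf'[OF inj])
  also have "\<dots> \<le> 1"
    by (rule measure_pmf.emeasure_le_1)
  finally show ?thesis .
qed

text \<open>A joint probability is at most its marginal. This bound is what gives \<open>U\<close>
  mean at most 1.\<close>

lemma pmf_mult_kernel_le:
  "pmf V w * pmf (K w) z \<le> pmf (bind_pmf V K) z"
proof -
  have "pmf V w * pmf (K w) z = measure (kernel_coupling V K) {(z, w)}"
    by (simp add: measure_pmf_single pmf_kernel_coupling)
  also have "\<dots> \<le> measure (kernel_coupling V K) (fst -` {z})"
    by (intro measure_pmf.finite_measure_mono) auto
  also have "\<dots> = pmf (bind_pmf V K) z"
    using pmf_map[of fst "kernel_coupling V K" z] by simp
  finally show ?thesis .
qed

section \<open>Mutual information of a coupling and the entropy bound\<close>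

text \<open>On the support, \<open>p(w, z) / (p(w) p(z)) = p(z | w) / p(z)\<close>. Both sides are
  Bochner integrals, so a non-integrable integrand gives 0 on both.\<close>

lemma mutual_information_kernel_coupling:
  fixes K :: "'w :: countable \<Rightarrow> 'z :: countable pmf"
  shows "prob_space.mutual_information (measure_pmf (kernel_coupling V K)) 2
      (count_space UNIV) (count_space UNIV) snd fst =
    (\<integral>x. log 2 (pmf (K (snd x)) (fst x) / pmf (bind_pmf V K) (fst x)) \<partial>kernel_coupling V K)"
proof -
  let ?Q = "kernel_coupling V K"
  have info: "information_space (measure_pmf ?Q) 2"
    by unfold_locales simp
  have distributed: "distributed (measure_pmf ?Q) (count_space UNIV) h (pmf (map_pmf h ?Q))"
    for h :: "'z \<times> 'w \<Rightarrow> 'c"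
    unfolding distributed_def map_pmf_rep_eq[symmetric]
    by (simp add: measure_pmf_eq_density[symmetric])
  have prod: "count_space UNIV \<Otimes>\<^sub>M count_space UNIV = (count_space UNIV :: ('w \<times> 'z) measure)"
    by (simp add: pair_measure_countable)
  \<comment> \<open>Mutual information of \<open>snd\<close> and \<open>fst\<close> refers to their
    joint law in that order, the reverse of the coupling's.\<close>
  let ?swap = "\<lambda>x :: 'z \<times> 'w. (snd x, fst x)"
  have "prob_space.mutual_information (measure_pmf ?Q) 2 (count_space UNIV) (count_space UNIV) snd fst =
      (\<integral>x. pmf (map_pmf ?swap ?Q) x * log 2 (pmf (map_pmf ?swap ?Q) x /
         (pmf (map_pmf snd ?Q) (fst x) * pmf (map_pmf fst ?Q) (snd x))) \<partial>count_space UNIV)"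
    unfolding prod[symmetric]
    by (rule information_space.mutual_information_distr[OF info _ _ distributed _ distributed])
      (simp_all add: prod distributed sigma_finite_measure_count_space)
  also have "\<dots> = (\<integral>x. log 2 (pmf (map_pmf ?swap ?Q) x /
      (pmf (map_pmf snd ?Q) (fst x) * pmf (map_pmf fst ?Q) (snd x))) \<partial>map_pmf ?swap ?Q)"
    by (simp add: measure_pmf_eq_density[of "map_pmf ?swap ?Q"] integral_density)
  also have "\<dots> = (\<integral>x. log 2 (pmf (map_pmf ?swap ?Q) (?swap x) /
      (pmf V (snd x) * pmf (bind_pmf V K) (fst x))) \<partial>?Q)"
    by simp
  also have "\<dots> = (\<integral>x. log 2 (pmf (K (snd x)) (fst x) / pmf (bind_pmf V K) (fst x)) \<partial>?Q)"
  proof (intro integral_cong_AE AE_pmfI)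
    fix x assume "x \<in> set_pmf ?Q"
    then have "pmf V (snd x) \<noteq> 0"
      by (auto simp: set_kernel_coupling set_pmf_iff)
    moreover have "pmf (map_pmf ?swap ?Q) (?swap x) = pmf ?Q x"
      by (rule pmf_map_inj') (auto simp: inj_on_def)
    ultimately show "log 2 (pmf (map_pmf ?swap ?Q) (?swap x) /
        (pmf V (snd x) * pmf (bind_pmf V K) (fst x))) =
        log 2 (pmf (K (snd x)) (fst x) / pmf (bind_pmf V K) (fst x))"
      using pmf_kernel_coupling[of V K "fst x" "snd x"] by simp
  qed simp_all
  finally show ?thesis .
qed

text \<open>On the support the \<open>info i\<close> sum to \<open>log 2 (U / p(w))\<close>, which
  is at most \<open>- log 2 p(w) + (U - 1) / ln 2\<close>. Integration leaves \<open>H(W)\<close>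
  plus a nonpositive term. Integrability of each \<open>info i\<close> allows exchanging sum and
  integral.\<close>

lemma sum_information_le_entropy:
  fixes V :: "'w pmf" and L :: "'w \<Rightarrow> 'z list pmf" and P :: "'z pmf"
  defines "info i x \<equiv> log 2 (pmf (map_pmf (\<lambda>zs. zs ! i) (L (snd x))) (fst x ! i) / pmf P (fst x ! i))"
  assumes L: "bind_pmf V L = replicate_pmf n P"
    and info: "\<And>i. i < n \<Longrightarrow> integrable (kernel_coupling V L) (info i)"
  shows "ennreal (\<Sum>i<n. \<integral>x. info i x \<partial>kernel_coupling V L) \<le> shannon_entropy V"
\<comment> \<open>The bound is trivial for infinite entropy; finiteness is what makes
  \<open>?h\<close> integrable below.\<close>
proof (cases "shannon_entropy V = \<infinity>")
  case False
  let ?Q = "kernel_coupling V L"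
  define t where "t i w zs = pmf (map_pmf (\<lambda>zs. zs ! i) (L w)) (zs ! i) / pmf P (zs ! i)" for i w zs
  define U where "U x = pmf V (snd x) * (\<Prod>i<n. t i (snd x) (fst x))" for x
  have supp: "length zs = n \<and> w \<in> set_pmf V \<and> (\<forall>i<n. 0 < pmf P (zs ! i) \<and> 0 < t i w zs)"
    if "(zs, w) \<in> set_pmf ?Q" for zs w
  proof -
    have w: "w \<in> set_pmf V" "zs \<in> set_pmf (L w)"
      using that by (auto simp: set_kernel_coupling)
    then have "zs \<in> set_pmf (replicate_pmf n P)"
      unfolding L[symmetric] by auto
    then have zs: "length zs = n" "set zs \<subseteq> set_pmf P"
      by (auto simp: set_replicate_pmf)
    then have "0 < pmf P (zs ! i)" if "i < n" for i
      using that by (intro pmf_positive) (auto dest: nth_mem)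
    moreover have "0 < pmf (map_pmf (\<lambda>zs. zs ! i) (L w)) (zs ! i)" for i
      using w by (intro pmf_positive) auto
    ultimately show ?thesis
      using w zs by (simp add: t_def)
  qed
  have U_nonneg: "0 \<le> U x" for x
    by (auto simp: U_def t_def intro!: mult_nonneg_nonneg prod_nonneg)
  have "(\<integral>\<^sup>+ x. ennreal (U x) \<partial>?Q) = (\<integral>\<^sup>+ w. \<integral>\<^sup>+ zs. ennreal (U (zs, w)) \<partial>L w \<partial>V)"
    by (rule nn_integral_kernel_coupling)
  also have "\<dots> \<le> (\<integral>\<^sup>+ w. 1 \<partial>V)"
  proof (intro nn_integral_mono_AE AE_pmfI)
    fix w assume w: "w \<in> set_pmf V"
    \<comment> \<open>Product of the coordinate marginals of \<open>L w\<close>. It dominates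
      \<open>p(zs | w) U\<close>, because the remaining factor \<open>p(w, zs) / p(zs)\<close> is at
      most 1.\<close>
    let ?f = "\<lambda>zs. \<Prod>i<n. pmf (map_pmf (\<lambda>zs. zs ! i) (L w)) (zs ! i)"
    have "(\<integral>\<^sup>+ zs. ennreal (U (zs, w)) \<partial>L w) =
        (\<integral>\<^sup>+ zs. ennreal (pmf (L w) zs * U (zs, w)) \<partial>count_space UNIV)"
      by (simp add: nn_integral_measure_pmf ennreal_mult U_nonneg)
    also have "\<dots> \<le> (\<integral>\<^sup>+ zs. ennreal (?f zs) * indicator {zs. length zs = n} zs \<partial>count_space UNIV)"
    proof (rule nn_integral_mono)
      fix zs :: "'z list"
      show "ennreal (pmf (L w) zs * U (zs, w)) \<le> ennreal (?f zs) * indicator {zs. length zs = n} zs"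
      proof (cases "zs \<in> set_pmf (L w)")
        case True
        then have *: "length zs = n" "\<And>i. i < n \<Longrightarrow> 0 < pmf P (zs ! i)"
          using supp[of zs w] w by (auto simp: set_kernel_coupling)
        let ?p = "\<Prod>i<n. pmf P (zs ! i)"
        have pos: "0 < ?p"
          using * by (intro prod_pos) auto
        have "pmf V w * pmf (L w) zs \<le> ?p"
          using pmf_mult_kernel_le[of V w L zs] * by (simp add: L pmf_replicate_pmf)
        then have "(pmf V w * pmf (L w) zs) / ?p \<le> 1"
          using pos by simp
        then have "(pmf V w * pmf (L w) zs) / ?p * ?f zs \<le> 1 * ?f zs"
          by (intro mult_right_mono prod_nonneg) auto
        then have "pmf (L w) zs * U (zs, w) \<le> ?f zs"
          by (simp add: U_def t_def prod_dividef ac_simps)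
        then show ?thesis
          using * by (simp add: ennreal_leI)
      qed (simp add: set_pmf_iff)
    qed
    also have "\<dots> = (\<integral>\<^sup>+ zs. ennreal (?f zs) \<partial>count_space {zs. length zs = n})"
      by (simp add: nn_integral_count_space_indicator)
    also have "\<dots> \<le> 1"
      by (rule nn_integral_lists_prod_pmf_le_1)
    finally show "(\<integral>\<^sup>+ zs. ennreal (U (zs, w)) \<partial>L w) \<le> 1" .
  qed
  finally have nn_U: "(\<integral>\<^sup>+ x. ennreal (U x) \<partial>?Q) \<le> 1"
    by simp
  then have int_U: "integrable ?Q U"
    by (intro integrableI_nonneg) (auto simp: U_nonneg intro: le_less_trans)
  have "ennreal (\<integral>x. U x \<partial>?Q) \<le> ennreal 1"
    using nn_U nn_integral_eq_integral[OF int_U] U_nonneg by simp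
  then have U_le: "(\<integral>x. U x \<partial>?Q) \<le> 1"
    by (subst (asm) ennreal_le_iff) auto
  let ?h = "\<lambda>x. - log 2 (pmf V (snd x))"
  have H: "shannon_entropy V = (\<integral>\<^sup>+ x. ennreal (?h x) \<partial>?Q)"
    unfolding shannon_entropy_def
    by (subst map_snd_kernel_coupling[of V L, symmetric]) (simp del: map_snd_kernel_coupling)
  have h_nonneg: "AE x in ?Q. 0 \<le> ?h x"
    by (rule AE_pmfI) (auto simp: set_kernel_coupling pmf_positive pmf_le_1)
  have int_h: "integrable ?Q ?h"
    using False h_nonneg H by (intro integrableI_nonneg) (auto simp: less_top)
  have "(\<Sum>i<n. \<integral>x. info i x \<partial>?Q) = (\<integral>x. (\<Sum>i<n. info i x) \<partial>?Q)"
    using info by (simp add: Bochner_Integration.integral_sum)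
  also have "\<dots> \<le> (\<integral>x. ?h x + (U x - 1) / ln 2 \<partial>?Q)"
  proof (rule integral_mono_AE)
    show "integrable ?Q (\<lambda>x. \<Sum>i<n. info i x)"
      using info by auto
    show "integrable ?Q (\<lambda>x. ?h x + (U x - 1) / ln 2)"
      using int_h int_U by auto
    show "AE x in ?Q. (\<Sum>i<n. info i x) \<le> ?h x + (U x - 1) / ln 2"
    proof (rule AE_pmfI)
      fix x assume x: "x \<in> set_pmf ?Q"
      obtain zs w where xz: "x = (zs, w)"
        by force
      note s = supp[OF x[unfolded xz]]
      have pos: "0 < pmf V w" "\<And>i. i < n \<Longrightarrow> 0 < t i w zs"
        using s by (auto simp: pmf_positive)
      then have posp: "0 < (\<Prod>i<n. t i w zs)"
        by (intro prod_pos) auto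
      \<comment> \<open>Positivity of every factor, from \<open>supp\<close>, allows the sum of
        logarithms to be collected into \<open>ln (U x) - ln (pmf V w)\<close>.\<close>
      have "(\<Sum>i<n. info i x) = (\<Sum>i<n. ln (t i w zs)) / ln 2"
        by (simp add: info_def t_def xz log_def sum_divide_distrib)
      also have "(\<Sum>i<n. ln (t i w zs)) = ln (\<Prod>i<n. t i w zs)"
        by (intro ln_prod[symmetric]) (auto dest!: pos(2))
      also have "\<dots> = ln (U x) - ln (pmf V w)"
        using ln_mult_pos[OF pos(1) posp] by (simp add: U_def xz)
      also have "ln (U x) \<le> U x - 1"
        using pos posp by (intro ln_le_minus_one) (simp add: U_def xz)
      finally show "(\<Sum>i<n. info i x) \<le> ?h x + (U x - 1) / ln 2"
        by (simp add: xz log_def diff_divide_distrib divide_right_mono)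
    qed
  qed
  also have "\<dots> = (\<integral>x. ?h x \<partial>?Q) + ((\<integral>x. U x \<partial>?Q) - 1) / ln 2"
    using int_h int_U by simp
  also have "\<dots> \<le> (\<integral>x. ?h x \<partial>?Q)"
    using U_le by (simp add: divide_nonpos_pos)
  finally have "ennreal (\<Sum>i<n. \<integral>x. info i x \<partial>?Q) \<le> ennreal (\<integral>x. ?h x \<partial>?Q)"
    by (rule ennreal_leI)
  also have "\<dots> = shannon_entropy V"
    unfolding H by (rule nn_integral_eq_integral[OF int_h h_nonneg, symmetric])
  finally show ?thesis .
qed simp

section \<open>Existence of the limit defining the rate\<close>

text \<open>Division of \<open>n\<close> by a near-optimal \<open>m\<close> gives
  \<open>a n / n \<le> a m / m + C / n\<close> with \<open>C\<close> independent of
  \<open>n\<close>, so the limit is the infimum over positive indices.\<close>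

lemma Fekete_subadditive:
  fixes a :: "nat \<Rightarrow> real"
  assumes nonneg: "\<And>n. 0 \<le> a n" and subadd: "\<And>m n. a (m + n) \<le> a m + a n"
  shows "convergent (\<lambda>n. a n / real n)"
proof -
  define l where "l = (INF n\<in>{1..}. a n / real n)"
  have bdd: "bdd_below ((\<lambda>n. a n / real n) ` {1..})"
    using nonneg by (intro bdd_belowI2[where m = 0]) simp
  have lower: "l \<le> a n / real n" if "n \<ge> 1" for n
    unfolding l_def by (rule cINF_lower[OF bdd]) (use that in simp)
  \<comment> \<open>The summand \<open>a 0\<close> accounts for \<open>q = 0\<close>: subadditivity
    does not force \<open>a 0\<close> to vanish.\<close>
  have mult: "a (q * m) \<le> real q * a m + a 0" for q m
  proof (induction q)
    case (Suc q)
    then show ?case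
      using subadd[of m "q * m"] by (simp add: algebra_simps)
  qed simp
  have "(\<lambda>n. a n / real n) \<longlonglongrightarrow> l"
  proof (rule LIMSEQ_I)
    fix e :: real assume e: "0 < e"
    then have "\<exists>m\<in>{1..}. a m / real m < l + e / 2"
      using cINF_less_iff[OF _ bdd, of "l + e / 2"] by (simp add: l_def)
    then obtain m where m: "m \<ge> 1" "a m / real m < l + e / 2"
      by auto
    \<comment> \<open>The sum bounds \<open>a (n mod m)\<close> uniformly in
      \<open>n\<close>.\<close>
    define C where "C = a 0 + (\<Sum>k<m. a k)"
    have C: "0 \<le> C"
      using nonneg by (simp add: C_def sum_nonneg)
    obtain N where N: "C / (e / 2) < real N"
      using reals_Archimedean2 by blast
    \<comment> \<open>\<open>Suc N\<close> in place of \<open>N\<close> also keeps \<open>n\<close>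
      positive for the divisions.\<close>
    have "norm (a n / real n - l) < e" if n: "n \<ge> Suc N" for n
    proof -
      have "a n \<le> a (n div m * m) + a (n mod m)"
        using subadd[of "n div m * m" "n mod m"] by simp
      also have "\<dots> \<le> real (n div m) * a m + a 0 + a (n mod m)"
        using mult[of "n div m" m] by simp
      also have "a (n mod m) \<le> (\<Sum>k<m. a k)"
        using m nonneg by (intro member_le_sum) auto
      also have "real (n div m) * a m \<le> real n / real m * a m"
        using nonneg by (intro mult_right_mono of_nat_div_le_of_nat)
      finally have "a n \<le> real n / real m * a m + C"
        by (simp add: C_def)
      then have "a n / real n \<le> (real n / real m * a m + C) / real n"
        by (rule divide_right_mono) simp
      also have "\<dots> = a m / real m + C / real n"
        using n by (simp add: field_simps)
      also have "C / real n < e / 2"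
      proof -
        have "C < real N * (e / 2)"
          using N e by (simp add: field_simps)
        also have "\<dots> \<le> real n * (e / 2)"
          using n e by (intro mult_right_mono) auto
        finally show ?thesis
          using n by (simp add: field_simps)
      qed
      finally have "a n / real n < l + e"
        using m by simp
      moreover have "l \<le> a n / real n"
        using n by (intro lower) simp
      ultimately show ?thesis
        by simp
    qed
    then show "\<exists>N. \<forall>n\<ge>N. norm (a n / real n - l) < e"
      by blast
  qed
  then show ?thesis
    by (rule convergentI)
qed

text \<open>The rate is defined by \<open>lim\<close>, which is informative only for a convergent
  sequence. All terms are finite, so the real version of Fekete's lemma applies.\<close>

lemma convergent_common_entropy_iid_pairs:
  fixes P :: "('a :: finite \<times> 'b :: finite) pmf"
  shows "\<exists>L. (\<lambda>n. common_entropy (iid_pairs n P) / of_nat n) \<longlonglongrightarrow> L"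
proof -
  define a where "a n = enn2real (common_entropy (iid_pairs n P))" for n
  have a: "common_entropy (iid_pairs n P) = ennreal (a n)" for n
    using common_entropy_iid_pairs_finite[of n P] by (simp add: a_def)
  have nonneg: "0 \<le> a n" for n
    by (simp add: a_def)
  have "a (m + n) \<le> a m + a n" for m n
    using common_entropy_iid_pairs_add[of m n P] nonneg
    by (simp add: a flip: ennreal_plus)
  from Fekete_subadditive[OF nonneg this] obtain l where "(\<lambda>n. a n / real n) \<longlonglongrightarrow> l"
    by (auto simp: convergent_def)
  then have "(\<lambda>n. ennreal (a n / real n)) \<longlonglongrightarrow> ennreal l"
    by (rule tendsto_ennrealI)
  \<comment> \<open>Index 0 is excluded: division by 0 gives 0 in the reals but may give
    \<open>\<top>\<close> in \<open>ennreal\<close>.\<close>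
  moreover have "\<forall>\<^sub>F n in sequentially.
      ennreal (a n / real n) = common_entropy (iid_pairs n P) / of_nat n"
    using eventually_gt_at_top[of 0]
    by eventually_elim (simp add: a nonneg divide_ennreal ennreal_of_nat_eq_real_of_nat)
  ultimately have "(\<lambda>n. common_entropy (iid_pairs n P) / of_nat n) \<longlonglongrightarrow> ennreal l"
    by (rule Lim_transform_eventually)
  then show ?thesis ..
qed

section \<open>Single-letter bound and passage to the limit\<close>

lemma wyner_common_information_le_common_entropy:
  fixes P :: "('a :: finite \<times> 'b :: finite) pmf"
  shows "of_nat n * wyner_common_information P \<le> common_entropy (iid_pairs n P)"
  unfolding common_entropy_def
proof (rule INF_greatest)
  fix Q assume "Q \<in> markov_couplings (iid_pairs n P)"
  then obtain V A B where Q: "Q = kernel_coupling V (\<lambda>w. pair_pmf (A w) (B w))"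
    and V: "bind_pmf V (\<lambda>w. pair_pmf (A w) (B w)) = iid_pairs n P"
    by (rule markov_couplings_kernel_cases)
  \<comment> \<open>Zipping turns the pair of lists into the list of the \<open>Z\<^sub>i\<close>;
    \<open>K i w\<close> is then the law of \<open>Z\<^sub>i\<close> given \<open>w\<close>.\<close>
  define L where "L w = map_pmf (\<lambda>(xs, ys). zip xs ys) (pair_pmf (A w) (B w))" for w
  define K where "K i w = map_pmf (\<lambda>zs. zs ! i) (L w)" for i w
  define info where
    "info i x = log 2 (pmf (K i (snd x)) (fst x ! i) / pmf P (fst x ! i))" for i x
  define I where "I i = (\<integral>x. info i x \<partial>kernel_coupling V L)" for i
  have "bind_pmf V L = map_pmf (\<lambda>(xs, ys). zip xs ys) (iid_pairs n P)"
    unfolding V[symmetric] by (simp add: L_def[abs_def] map_bind_pmf)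
  also have "\<dots> = replicate_pmf n P"
    by (simp add: iid_pairs_def map_pmf_comp zip_map_fst_snd)
  finally have L: "bind_pmf V L = replicate_pmf n P" .
  have K: "bind_pmf V (K i) = P" if "i < n" for i
    using map_nth_replicate_pmf[OF that, of P]
    by (simp add: K_def[abs_def] map_bind_pmf flip: L)
  \<comment> \<open>\<open>zip\<close> truncates to the shorter list, so its entries are
    \<open>(xs ! i, ys ! i)\<close> only once the lengths are known.\<close>
  have len: "length xs = n \<and> length ys = n"
    if "w \<in> set_pmf V" "xs \<in> set_pmf (A w)" "ys \<in> set_pmf (B w)" for w xs ys
  proof -
    have "(xs, ys) \<in> set_pmf (iid_pairs n P)"
      unfolding V[symmetric] using that by auto
    then show ?thesis
      by (auto simp: iid_pairs_def set_replicate_pmf)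
  qed
  have K_pair: "K i w = pair_pmf (map_pmf (\<lambda>xs. xs ! i) (A w)) (map_pmf (\<lambda>ys. ys ! i) (B w))"
    if "w \<in> set_pmf V" "i < n" for i w
  proof -
    have "K i w = map_pmf (\<lambda>(xs, ys). (xs ! i, ys ! i)) (pair_pmf (A w) (B w))"
      unfolding K_def L_def map_pmf_comp
      using that len[OF that(1)] by (intro map_pmf_cong) auto
    then show ?thesis
      by (simp add: map_pair)
  qed
  have wyner_le: "wyner_common_information P \<le> ennreal (I i)" if i: "i < n" for i
  proof -
    \<comment> \<open>This kernel is a product for every \<open>w\<close>, as the introduction lemma
      demands, and agrees with \<open>K i\<close> on the support of \<open>V\<close>.\<close>
    let ?K = "\<lambda>w. pair_pmf (map_pmf (\<lambda>xs. xs ! i) (A w)) (map_pmf (\<lambda>ys. ys ! i) (B w))"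
    have "bind_pmf V ?K = P"
      using K[OF i] K_pair[OF _ i] by (simp cong: bind_pmf_cong_simp)
    then have "kernel_coupling V ?K \<in> markov_couplings P"
      by (rule kernel_coupling_in_markov_couplings)
    moreover have "kernel_coupling V ?K = kernel_coupling V (K i)"
      unfolding kernel_coupling_def using K_pair[OF _ i] by (intro bind_pmf_cong) auto
    ultimately have coupling: "kernel_coupling V (K i) \<in> markov_couplings P"
      by simp
    \<comment> \<open>A change of variables turns every single-letter information into an integral
      over the one coupling of \<open>V\<close> with \<open>L\<close>, where they can be
      summed.\<close>
    have map: "kernel_coupling V (K i) = map_pmf (\<lambda>x. (fst x ! i, snd x)) (kernel_coupling V L)"
      by (simp add: kernel_coupling_def K_def map_bind_pmf map_pmf_comp)
    have "prob_space.mutual_information (measure_pmf (kernel_coupling V (K i))) 2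
        (count_space UNIV) (count_space UNIV) snd fst =
      (\<integral>x. log 2 (pmf (K i (snd x)) (fst x) / pmf P (fst x)) \<partial>kernel_coupling V (K i))"
      by (simp add: mutual_information_kernel_coupling K[OF i])
    also have "\<dots> = I i"
      unfolding map integral_map_pmf by (simp add: I_def info_def)
    finally show ?thesis
      unfolding wyner_common_information_def by (intro INF_lower2[OF coupling]) simp
  qed
  show "of_nat n * wyner_common_information P \<le> shannon_entropy (map_pmf snd Q)"
  proof (cases "n = 0 \<or> wyner_common_information P = 0")
    case False
    \<comment> \<open>Coordinate 0 exists because \<open>n\<close> is positive in this case.\<close>
    then have "wyner_common_information P < \<top>"
      using wyner_le[of 0] by (auto intro: le_less_trans)
    then obtain r where r: "wyner_common_information P = ennreal r" "0 \<le> r"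
      by (cases "wyner_common_information P") auto
    have "0 < r"
      using r False by (cases "r = 0") auto
    then have r_le: "r \<le> I i" if "i < n" for i
      using wyner_le[OF that] r by (metis ennreal_le_iff2 not_le)
    \<comment> \<open>The Bochner integral of a non-integrable function is 0, but \<open>I i \<ge> r > 0\<close>.\<close>
    have "integrable (kernel_coupling V L) (info i)" if "i < n" for i
      using r_le[OF that] \<open>0 < r\<close> not_integrable_integral_eq[of _ "info i"]
      unfolding I_def by fastforce
    then have "ennreal (\<Sum>i<n. I i) \<le> shannon_entropy V"
      unfolding I_def info_def K_def by (intro sum_information_le_entropy[OF L])
    moreover have "of_nat n * wyner_common_information P = ennreal (\<Sum>i<n. r)"
      by (simp add: r ennreal_mult flip: ennreal_of_nat_eq_real_of_nat)
    moreover have "ennreal (\<Sum>i<n. r) \<le> ennreal (\<Sum>i<n. I i)"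
      using r_le by (intro ennreal_leI sum_mono) auto
    ultimately show ?thesis
      by (simp add: Q)
  qed auto
qed

theorem proposition3:
  fixes P :: "('a :: finite \<times> 'b :: finite) pmf"
  shows "common_entropy_rate P \<ge> wyner_common_information P"
proof -
  obtain L where L: "(\<lambda>n. common_entropy (iid_pairs n P) / of_nat n) \<longlonglongrightarrow> L"
    using convergent_common_entropy_iid_pairs by blast
  have "\<forall>\<^sub>F n in sequentially.
      wyner_common_information P \<le> common_entropy (iid_pairs n P) / of_nat n"
    \<comment> \<open>Cancelling \<open>of_nat n\<close> below needs \<open>n\<close> to be
      positive.\<close>
    using eventually_gt_at_top[of 0]
  proof eventually_elim
    case (elim n)
    have "wyner_common_information P = of_nat n * wyner_common_information P / of_nat n"
      using elim by (simp add: ennreal_times_divide mult.commute mult_divide_eq_ennreal)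
    also have "\<dots> \<le> common_entropy (iid_pairs n P) / of_nat n"
      by (rule divide_right_mono_ennreal[OF wyner_common_information_le_common_entropy])
    finally show ?case .
  qed
  then have "wyner_common_information P \<le> L"
    using L by (intro tendsto_lowerbound[OF L]) simp_all
  then show ?thesis
    unfolding common_entropy_rate_def limI[OF L] .
qed

end
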